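(* Let $k\ge1$ and $l\ge7$ be integers satisfying $3+\widehat{c}_{k+l}\ge2\,\widehat{c}_k$. For $i=0,1,\dots,l$ put $C(k,l)_i=\mathcal{C}^{o}_{>1}(k+l)\setminus\{\widehat{c}_{k+i}\}$. If $2\,\mathbb{Z}^{o}_{\ge3}=2\,(\mathbb{Z}^{o}_{\ge3}\setminus C(k,l)_i)$ for every $i\in\{0,1,\dots,l\}$, then $2\,\mathbb{Z}^{o}_{\ge3}=2\,(\mathbb{Z}^{o}_{\ge3}\setminus\mathcal{C}^{o}_{>1}(k+l))$.
   Context: $\mathbb{Z}^{o}_{\ge3}$ is the set of all odd integers $\ge3$. $\widehat{c}_1<\widehat{c}_2<\cdots$ is the increasing enumeration of all odd composite positive integers ($\widehat{c}_1=9,\ \widehat{c}_2=15,\ \widehat{c}_3=21,\dots$), and $\mathcal{C}^{o}_{>1}(m)=\{\widehat{c}_1,\dots,\widehat{c}_m\}$ is the set of the first $m$ of them. For a non-empty set $S$ of integers, $2S=\{s+s': s,s'\in S\}$ (the sumset). *)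

theory Defs
  imports Complex_Main "HOL-Library.Infinite_Set" "HOL-Library.Set_Algebras"
    "HOL-Computational_Algebra.Primes"
begin

definition odd_ge3 :: "int set" where
  "odd_ge3 = {n. odd n \<and> n \<ge> 3}"

text \<open>The type of naturals is used here because \<^const>\<open>enumerate\<close> needs a well-order.\<close>
definition odd_composites :: "nat set" where
  "odd_composites = {n. odd n \<and> n > 1 \<and> \<not> prime n}"

text \<open>Indices start at 1, whereas \<^const>\<open>enumerate\<close> starts at 0; index 0 is not used.\<close>
definition chat :: "nat \<Rightarrow> int" where
  "chat n = int (enumerate odd_composites (n - 1))"

definition first_composites :: "nat \<Rightarrow> int set" where
  "first_composites m = chat ` {1..m}"

definition two_fold :: "int set \<Rightarrow> int set" where
  "two_fold S = S + S"

definition C_omit :: "nat \<Rightarrow> nat \<Rightarrow> nat \<Rightarrow> int set" where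
  "C_omit k l i = first_composites (k + l) - {chat (k + i)}"

lemma two_fold_iff: "x \<in> two_fold S \<longleftrightarrow> (\<exists>s\<in>S. \<exists>s'\<in>S. x = s + s')"
  by (auto simp: two_fold_def set_plus_def)

lemma infinite_odd_composites: "infinite odd_composites"
proof -
  have "range (\<lambda>n::nat. 3 * (2 * n + 3)) \<subseteq> odd_composites"
  proof -
    have "\<not> prime (3 * (2 * n + 3))" for n :: nat
      using prime_product[of 3 "2 * n + 3"] by auto
    moreover have "1 < 3 * (2 * n + 3)" "odd (3 * (2 * n + 3))" for n :: nat
      by simp_all
    ultimately show ?thesis
      unfolding odd_composites_def by blast
  qed
  moreover have "inj (\<lambda>n::nat. 3 * (2 * n + 3))"
    by (auto simp: inj_def)
  ultimately show ?thesis
    using infinite_super range_inj_infinite by blast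
qed

lemma chat_less: "1 \<le> m \<Longrightarrow> m < n \<Longrightarrow> chat m < chat n"
  by (auto simp: chat_def intro!: enumerate_mono infinite_odd_composites)

lemma chat_range: "chat ` {1..} = int ` odd_composites"
proof -
  have "(\<lambda>n. n - 1) ` {1..} = (UNIV :: nat set)"
    by (auto intro!: image_eqI[where x = "Suc _"])
  then have "chat ` {1..} = int ` (enumerate odd_composites ` UNIV)"
    unfolding chat_def by (metis (no_types, lifting) image_image image_cong)
  then show ?thesis
    using range_enumerate[OF infinite_odd_composites] by simp
qed

lemma chat_1: "chat 1 = 9"
proof -
  have "\<not> prime (9::nat)"
    using prime_product[of 3 3] by auto
  moreover have "9 \<le> n" if "odd n" "n > 1" "\<not> prime n" for n :: nat
  proof (rule ccontr)
    assume "\<not> 9 \<le> n"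
    then have "n \<in> {2,3,4,5,6,7,8}" using that by auto
    then show False using that by auto
  qed
  ultimately have "(LEAST n. n \<in> odd_composites) = 9"
    by (intro Least_equality) (auto simp: odd_composites_def)
  then show ?thesis by (simp add: chat_def enumerate_0)
qed

end

theory Submission
  imports Defs
begin

text \<open>
  Write \<open>M\<close> for the largest of the removed composites. If \<open>n > M + 3\<close> then
  \<open>n = 3 + (n - 3)\<close> is a representation avoiding all of them. If \<open>n\<close> has no such
  representation, then restoring a single composite \<open>c\<close> makes it representable only through
  \<open>c\<close>; taking \<open>c = M\<close> gives \<open>n \<ge> M + 3\<close>, so \<open>n = M + 3\<close>. As \<open>n \<ge> 42\<close>, it is a sum
  \<open>a + b\<close> of two odd composites \<open>a < b\<close>, and \<open>b > n / 2 \<ge> chat k\<close>, so \<open>b\<close> is one of the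
  composites that may be restored. The restored \<open>b\<close> can only be completed by \<open>a\<close>, which is
  still removed: a contradiction.
\<close>

lemma odd_composites_mult:
  assumes "odd a" "odd b" "a > 1" "b > 1"
  shows "a * b \<in> odd_composites"
  using assms prime_product[of a b] less_1_mult[of a b] by (auto simp: odd_composites_def)

text \<open>Subtracting 9, 35 or 25, according as \<open>n mod 6\<close> is 0, 2 or 4, leaves an odd
  multiple of 3 that is at least 9, hence an odd composite.\<close>

lemma even_eq_sum_odd_composites:
  fixes n :: nat
  assumes "even n" "n \<ge> 42"
  obtains a b where "a \<in> odd_composites" "b \<in> odd_composites" "a < b" "n = a + b"
proof -
  note sum_of = that
  \<comment> \<open>The two summands only have to differ: whichever is smaller plays the role of
    \<open>a\<close>.\<close>
  have *: thesis if "a \<in> odd_composites" "n = a + 3 * (2 * t + 3)" "a \<noteq> 3 * (2 * t + 3)" for a t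
  proof -
    have "3 * (2 * t + 3) \<in> odd_composites"
      by (rule odd_composites_mult) auto
    with that show thesis
      using sum_of[of a "3 * (2 * t + 3)"] sum_of[of "3 * (2 * t + 3)" a] by linarith
  qed
  have 9: "9 \<in> odd_composites" and 25: "25 \<in> odd_composites" and 35: "35 \<in> odd_composites"
    using odd_composites_mult[of 3 3] odd_composites_mult[of 5 5] odd_composites_mult[of 5 7]
    by simp_all
  have "n mod 6 = 0 \<or> n mod 6 = 2 \<or> n mod 6 = 4"
    using assms(1) by presburger
  then show thesis
  proof (elim disjE)
    assume "n mod 6 = 0"
    then show thesis using assms 9 by (intro *[of 9 "n div 6 - 3"]) presburger+
  next
    assume "n mod 6 = 2"
    then show thesis using assms 35 by (intro *[of 35 "n div 6 - 7"]) presburger+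
  next
    assume "n mod 6 = 4"
    then show thesis using assms 25 by (intro *[of 25 "n div 6 - 5"]) presburger+
  qed
qed

lemma chat_in_odd_composites: "m \<ge> 1 \<Longrightarrow> \<exists>c\<in>odd_composites. chat m = int c"
  using chat_range by fastforce

text \<open>As \<open>chat\<close> is increasing and reaches every odd composite, a bound on the
  value replaces a bound on the index.\<close>

lemma first_composites_iff:
  assumes "m \<ge> 1"
  shows "x \<in> first_composites m \<longleftrightarrow> x \<in> int ` odd_composites \<and> x \<le> chat m"
proof
  assume "x \<in> first_composites m"
  then obtain j where j: "1 \<le> j" "j \<le> m" "x = chat j"
    by (auto simp: first_composites_def)
  then have "chat j \<le> chat m"
    using chat_less[of j m] by (cases "j = m") auto
  with j show "x \<in> int ` odd_composites \<and> x \<le> chat m"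
    using chat_in_odd_composites[of j] by auto
next
  assume x: "x \<in> int ` odd_composites \<and> x \<le> chat m"
  then obtain j where "1 \<le> j" "x = chat j"
    using chat_range by (metis atLeast_iff imageE)
  with x have "j \<le> m"
    using chat_less[of m j] assms by (meson not_le)
  with \<open>1 \<le> j\<close> \<open>x = chat j\<close> show "x \<in> first_composites m"
    by (auto simp: first_composites_def)
qed

lemma card_first_composites: "card (first_composites m) = m"
proof -
  have "inj_on chat {1..m}"
    by (rule linorder_inj_onI) (use chat_less in fastforce)+
  then show ?thesis
    by (simp add: first_composites_def card_image)
qed

text \<open>Only seven odd composites lie below 39, too few for eight distinct values. With
  \<open>k + l \<ge> 8\<close> this yields the bound 42 on \<open>n\<close>.\<close>

lemma chat_ge_39:
  assumes "m \<ge> 8"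
  shows "chat m \<ge> 39"
proof (rule ccontr)
  assume "\<not> chat m \<ge> 39"
  have "first_composites m \<subseteq> {9, 15, 21, 25, 27, 33, 35}"
  proof
    fix x assume "x \<in> first_composites m"
    then obtain c where c: "x = int c" "odd c" "c > 1" "\<not> prime c" "x \<le> chat m"
      using assms by (auto simp: first_composites_iff odd_composites_def)
    with \<open>\<not> chat m \<ge> 39\<close> have "c < 39" by simp
    with c have "c \<in> {3,5,7,9,11,13,15,17,19,21,23,25,27,29,31,33,35,37}"
      unfolding insert_iff empty_iff by presburger
    moreover have "prime c" if "c \<in> {3,5,7,11,13,17,19,23,29,31,37}"
      using that by (auto simp: prime_nat_numeral_eq)
    ultimately show "x \<in> {9, 15, 21, 25, 27, 33, 35}"
      using c by auto
  qed
  then have "card (first_composites m) \<le> card {9, 15, 21, 25, 27, 33, 35 :: int}"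
    by (intro card_mono) auto
  with assms show False
    by (simp add: card_first_composites)
qed

theorem theorem3p12:
  fixes k l :: nat
  assumes "k \<ge> 1" and "l \<ge> 7"
    and "3 + chat (k + l) \<ge> 2 * chat k"
    and "\<forall>i\<in>{0..l}. two_fold odd_ge3 = two_fold (odd_ge3 - C_omit k l i)"
  shows "two_fold odd_ge3 = two_fold (odd_ge3 - first_composites (k + l))"
proof
  let ?M = "chat (k + l)" and ?C = "first_composites (k + l)"
  have C_iff: "x \<in> ?C \<longleftrightarrow> x \<in> int ` odd_composites \<and> x \<le> ?M" for x
    using assms(1) by (intro first_composites_iff) simp
  have M: "?M \<ge> 39" "odd ?M"
    using chat_ge_39[of "k + l"] chat_in_odd_composites[of "k + l"] assms(1,2)
    by (auto simp: odd_composites_def)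
  show "two_fold odd_ge3 \<subseteq> two_fold (odd_ge3 - ?C)"
  proof (rule subsetI, rule ccontr)
    fix n assume n: "n \<in> two_fold odd_ge3" and not: "n \<notin> two_fold (odd_ge3 - ?C)"
    have restore: "n - chat (k + i) \<in> odd_ge3 - C_omit k l i" if "i \<le> l" for i
    proof -
      have "n \<in> two_fold (odd_ge3 - C_omit k l i)"
        using assms(4) n that by auto
      then obtain s t where st: "s \<in> odd_ge3 - C_omit k l i" "t \<in> odd_ge3 - C_omit k l i" "n = s + t"
        by (auto simp: two_fold_iff)
      then have "s = chat (k + i) \<or> t = chat (k + i)"
        using not by (auto simp: two_fold_iff C_omit_def)
      with st show ?thesis by auto
    qed
    have "n \<ge> ?M + 3"
      using restore[of l] by (simp add: odd_ge3_def)
    moreover have "even n"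
      using n by (auto simp: two_fold_iff odd_ge3_def)
    moreover have "n \<le> ?M + 3"
    proof (rule ccontr)
      assume "\<not> n \<le> ?M + 3"
      with \<open>even n\<close> M have "n - 3 \<in> odd_ge3 - ?C"
        by (auto simp: odd_ge3_def C_iff)
      moreover have "3 \<in> odd_ge3 - ?C"
        by (auto simp: odd_ge3_def C_iff odd_composites_def)
      ultimately show False
        using not by (force simp: two_fold_iff)
    qed
    ultimately have n_eq: "n = ?M + 3" by simp
    have "even (nat n)" "nat n \<ge> 42"
      using \<open>even n\<close> n_eq M by (simp_all add: even_nat_iff)
    then obtain a b where ab: "a \<in> odd_composites" "b \<in> odd_composites" "a < b" "nat n = a + b"
      by (rule even_eq_sum_odd_composites)
    then have n_ab: "n = int a + int b" using n_eq M by simp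
    have "a \<ge> 3"
      using ab(1) by (auto simp: odd_composites_def elim: oddE)
    \<comment> \<open>Both summands are at least 3 and add up to \<open>?M + 3\<close>, so neither
      exceeds \<open>?M\<close>.\<close>
    then have "int a \<in> ?C" "int b \<in> ?C"
      using ab n_ab n_eq by (auto simp: C_iff)
    then obtain j where j: "j \<le> k + l" "int b = chat j" "j \<ge> 1"
      by (auto simp: first_composites_def)
    have "chat k < chat j"
      using assms(3) n_ab n_eq j(2) ab(3) by linarith
    then have "k \<le> j"
      using chat_less[of j k] j(3) by (meson not_le order_less_asym)
    \<comment> \<open>For \<open>i = j - k\<close>, which is at most \<open>l\<close>, the restored
      composite \<open>chat (k + i)\<close> is \<open>b\<close>, and \<open>n - b\<close> is
      \<open>a\<close>.\<close>
    then have "int a \<notin> C_omit k l (j - k)"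
      using restore[of "j - k"] j n_ab by simp
    with \<open>int a \<in> ?C\<close> \<open>k \<le> j\<close> j(2) ab(3) show False
      by (auto simp: C_omit_def)
  qed
  show "two_fold (odd_ge3 - ?C) \<subseteq> two_fold odd_ge3"
    unfolding two_fold_def by (rule set_plus_mono2) auto
qed

end
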